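(* If $\Gamma$ is a game with $7$ vertices, then $\Gamma$ is isomorphic to exactly one of $\Gamma_I$, $\Gamma_{II}$ or $\Gamma_{III}$.
   Context: A tournament on a finite set is a relation without loops such that for distinct $i,j$ exactly one of $i\to j$, $j\to i$ holds; a game with $7$ vertices is a tournament on a $7$-element set in which every vertex has exactly $3$ outputs and $3$ inputs. Isomorphisms are bijections of vertices preserving $\to$ in both directions. For $A\subset\mathbb{Z}_7$ with $\mathbb{Z}_7$ the disjoint union $A\cup(-A)\cup\{0\}$, $\Gamma[A]=\{(i,j)\in\mathbb{Z}_7\times\mathbb{Z}_7:j-i\in A\}$. Define $\Gamma_I=\Gamma[\{1,2,3\}]$ and $\Gamma_{II}=\Gamma[\{1,2,4\}]$. $\Gamma_{III}$ is the game on $\{0,1,\dots,6\}$ with edges: $3\to0$, $6\to0$, $5\to0$; $0\to1$, $0\to2$, $0\to4$; $1\to2$, $2\to4$, $4\to1$; $3\to6$, $6\to5$, $5\to3$; $1\to3$, $2\to6$, $4\to5$; $2\to3$, $4\to6$, $1\to5$; $6\to1$, $5\to2$, $3\to4$. *)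

theory Defs
  imports Main "HOL-Library.Numeral_Type"
begin

text \<open>A relation on the vertex set \<open>V\<close> is a set of pairs; \<open>(i, j) \<in> R\<close> means \<open>i \<rightarrow> j\<close>.\<close>

definition tournament :: "'a set \<Rightarrow> 'a rel \<Rightarrow> bool" where
  "tournament V R \<longleftrightarrow> finite V \<and> R \<subseteq> V \<times> V \<and> irrefl R \<and>
     (\<forall>i\<in>V. \<forall>j\<in>V. i \<noteq> j \<longrightarrow> ((i, j) \<in> R) \<noteq> ((j, i) \<in> R))"

definition game7 :: "'a set \<Rightarrow> 'a rel \<Rightarrow> bool" where
  "game7 V R \<longleftrightarrow> tournament V R \<and> card V = 7 \<and>
     (\<forall>i\<in>V. card {j\<in>V. (i, j) \<in> R} = 3 \<and> card {j\<in>V. (j, i) \<in> R} = 3)"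

definition tournament_iso :: "'a set \<Rightarrow> 'a rel \<Rightarrow> 'b set \<Rightarrow> 'b rel \<Rightarrow> ('a \<Rightarrow> 'b) \<Rightarrow> bool" where
  "tournament_iso V R W S f \<longleftrightarrow> bij_betw f V W \<and>
     (\<forall>i\<in>V. \<forall>j\<in>V. (i, j) \<in> R \<longleftrightarrow> (f i, f j) \<in> S)"

definition isomorphic :: "'a set \<Rightarrow> 'a rel \<Rightarrow> 'b set \<Rightarrow> 'b rel \<Rightarrow> bool" where
  "isomorphic V R W S \<longleftrightarrow> (\<exists>f. tournament_iso V R W S f)"

text \<open>The ring of integers modulo 7 is the numeral type \<open>7\<close>. The set \<open>\<Gamma>[A]\<close> is meant
  only for those \<open>A\<close> that satisfy \<open>game_subset\<close>.\<close>

definition game_subset :: "7 set \<Rightarrow> bool" where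
  "game_subset A \<longleftrightarrow> A \<union> uminus ` A \<union> {0} = UNIV \<and> A \<inter> uminus ` A = {} \<and>
     0 \<notin> A \<and> 0 \<notin> uminus ` A"

definition Gamma :: "7 set \<Rightarrow> 7 rel" where
  "Gamma A = {(i, j). j - i \<in> A}"

definition Gamma_I :: "7 rel" where
  "Gamma_I = Gamma {1, 2, 3}"

definition Gamma_II :: "7 rel" where
  "Gamma_II = Gamma {1, 2, 4}"

definition Gamma_III :: "nat rel" where
  "Gamma_III =
     {(3, 0), (6, 0), (5, 0),
      (0, 1), (0, 2), (0, 4),
      (1, 2), (2, 4), (4, 1),
      (3, 6), (6, 5), (5, 3),
      (1, 3), (2, 6), (4, 5),
      (2, 3), (4, 6), (1, 5),
      (6, 1), (5, 2), (3, 4)}"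

lemma UNIV_7: "(UNIV :: 7 set) = {0, 1, 2, 3, 4, 5, 6}"
proof -
  have "card {0, 1, 2, 3, 4, 5, 6 :: 7} = 7" by simp
  then show ?thesis
    by (intro sym[OF card_subset_eq]) (simp_all only: card_num1 finite subset_UNIV, simp)
qed

lemma game_subset_I: "game_subset {1, 2, 3}"
  and game_subset_II: "game_subset {1, 2, 4}"
  unfolding game_subset_def UNIV_7 by auto

lemma game7_Gamma:
  assumes A: "game_subset A" and "card A = 3"
  shows "game7 UNIV (Gamma A)"
proof -
  have *: "x \<in> (\<lambda>a. i + a) ` A" if "x - i \<in> A" for x i
    using imageI[OF that, of "\<lambda>a. i + a"] by simp
  have **: "x \<in> (\<lambda>a. i - a) ` A" if "i - x \<in> A" for x i
    using imageI[OF that, of "\<lambda>a. i - a"] by simp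
  have "{j. (i, j) \<in> Gamma A} = (\<lambda>a. i + a) ` A"
    and "{j. (j, i) \<in> Gamma A} = (\<lambda>a. i - a) ` A" for i
    by (auto simp: Gamma_def intro: * **)
  moreover have "inj (\<lambda>a. i + a)" "inj (\<lambda>a. i - a)" for i :: 7
    by (auto intro: injI)
  ultimately have deg: "card {j. (i, j) \<in> Gamma A} = 3 \<and> card {j. (j, i) \<in> Gamma A} = 3" for i
    using assms(2) by (simp add: card_image inj_on_subset[OF _ subset_UNIV])
  have one: "(d \<in> A) \<noteq> (- d \<in> A)" if "d \<noteq> 0" for d
  proof -
    have im: "d \<in> uminus ` A \<longleftrightarrow> - d \<in> A" by force
    from A have "d \<in> A \<union> uminus ` A \<union> {0}" "d \<notin> A \<inter> uminus ` A"
      by (simp_all add: game_subset_def)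
    with that im show ?thesis by blast
  qed
  have "\<forall>i\<in>UNIV. \<forall>j\<in>UNIV. i \<noteq> j \<longrightarrow> ((i, j) \<in> Gamma A) \<noteq> ((j, i) \<in> Gamma A)"
  proof (intro ballI impI)
    fix i j :: 7
    assume "i \<noteq> j"
    then show "((i, j) \<in> Gamma A) \<noteq> ((j, i) \<in> Gamma A)"
      using one[of "j - i"] by (simp add: Gamma_def)
  qed
  moreover have "irrefl (Gamma A)"
    using A by (simp add: irrefl_def Gamma_def game_subset_def)
  ultimately have "tournament UNIV (Gamma A)"
    unfolding tournament_def by (intro conjI) (assumption | rule finite | simp)+
  then show ?thesis using deg by (simp add: game7_def)
qed

lemma game7_Gamma_I: "game7 UNIV Gamma_I"
  and game7_Gamma_II: "game7 UNIV Gamma_II"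
  by (simp_all add: Gamma_I_def Gamma_II_def game7_Gamma game_subset_I game_subset_II)

lemma game7_Gamma_III: "game7 {0..6} Gamma_III"
proof -
  have V: "{0..6::nat} = {0, 1, 2, 3, 4, 5, 6}" by auto
  have "{j\<in>{0..6}. (i, j) \<in> Gamma_III} =
      (if i = 0 then {1, 2, 4} else if i = 1 then {2, 3, 5} else if i = 2 then {3, 4, 6}
       else if i = 3 then {0, 4, 6} else if i = 4 then {1, 5, 6} else if i = 5 then {0, 2, 3}
       else {0, 1, 5})"
    and "{j\<in>{0..6}. (j, i) \<in> Gamma_III} =
      (if i = 0 then {3, 5, 6} else if i = 1 then {0, 4, 6} else if i = 2 then {0, 1, 5}
       else if i = 3 then {1, 2, 5} else if i = 4 then {0, 2, 3} else if i = 5 then {1, 4, 6}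
       else {2, 3, 4})" if "i \<in> {0..6}" for i
    using that unfolding V Gamma_III_def by auto
  moreover have "tournament {0..6} Gamma_III"
    unfolding tournament_def V Gamma_III_def irrefl_def by auto
  ultimately show ?thesis by (simp add: game7_def)
qed

end

theory Submission
  imports Defs
begin

text \<open>
  Fix a vertex \<open>v\<close> with outputs \<open>T\<close> and inputs \<open>S\<close>. Each of the tournaments on the three-element
  sets \<open>T\<close> and \<open>S\<close> is a 3-cycle or transitive. If one of them is transitive, the degree conditions
  determine the nine edges between \<open>T\<close> and \<open>S\<close> up to rotating the other triple when it is a
  3-cycle, and the game is \<open>\<Gamma>\<^sub>I\<close> or \<open>\<Gamma>\<^sub>I\<^sub>I\<^sub>I\<close>. If both are cyclic, the edges from \<open>S\<close> to \<open>T\<close> form a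
  perfect matching, which preserves or reverses the cyclic order; this gives \<open>\<Gamma>\<^sub>I\<^sub>I\<^sub>I\<close> and \<open>\<Gamma>\<^sub>I\<^sub>I\<close>.
  The three games are told apart by whether some vertex dominates a 3-cycle (not in \<open>\<Gamma>\<^sub>I\<close>) and
  whether some vertex dominates a transitive triple (not in \<open>\<Gamma>\<^sub>I\<^sub>I\<close>).
\<close>

section \<open>Isomorphisms of tournaments\<close>

text \<open>Identifying two vertices of \<open>W\<close> would turn the edge between them into a
  loop, so \<open>f\<close> is injective, and by counting bijective. Edges are reflected because the
  opposite edge would be preserved too. As \<open>f\<close> runs from the model into
  \<open>V\<close>, only the edges of the model need checking.\<close>

lemma tournament_isomorphicI:
  assumes V: "tournament V R" and W: "tournament W S" and card: "card V = card W"
    and f: "f ` W \<subseteq> V" "\<And>i j. (i, j) \<in> S \<Longrightarrow> (f i, f j) \<in> R"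
  shows "isomorphic V R W S"
proof -
  have R: "irrefl R" "finite V"
    "\<And>i j. \<lbrakk>i \<in> V; j \<in> V; i \<noteq> j\<rbrakk> \<Longrightarrow> ((i, j) \<in> R) \<noteq> ((j, i) \<in> R)"
    using V unfolding tournament_def by blast+
  have S: "irrefl S" "\<And>i j. \<lbrakk>i \<in> W; j \<in> W; i \<noteq> j\<rbrakk> \<Longrightarrow> ((i, j) \<in> S) \<noteq> ((j, i) \<in> S)"
    using W unfolding tournament_def by blast+
  have inj: "inj_on f W"
    using R(1) S(2) f(2) unfolding inj_on_def irrefl_def by metis
  with card R(2) f(1) have "f ` W = V"
    by (intro card_subset_eq) (simp_all add: card_image)
  with inj have bij: "bij_betw f W V"
    by (simp add: bij_betw_def)
  define g where "g = inv_into W f"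
  have g: "bij_betw g V W" "\<And>i. i \<in> V \<Longrightarrow> f (g i) = i"
    using bij by (auto simp: g_def bij_betw_inv_into bij_betw_inv_into_right)
  have "(i, j) \<in> R \<longleftrightarrow> (g i, g j) \<in> S" if ij: "i \<in> V" "j \<in> V" for i j
  proof -
    have "g i \<in> W" "g j \<in> W"
      using g(1) ij by (auto simp: bij_betw_def)
    then show ?thesis
      using R(1,3) S f(2) g(2) ij unfolding irrefl_def by metis
  qed
  with g(1) show ?thesis
    by (auto simp: isomorphic_def tournament_iso_def)
qed

section \<open>Invariants separating the three games\<close>

definition dominates_cycle :: "'a rel \<Rightarrow> bool" where
  "dominates_cycle R \<longleftrightarrow> (\<exists>v x y z. {(v, x), (v, y), (v, z), (x, y), (y, z), (z, x)} \<subseteq> R)"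

text \<open>In both patterns any two of the four vertices are joined by an edge, so irreflexivity
  makes them distinct.\<close>

definition dominates_transitive :: "'a rel \<Rightarrow> bool" where
  "dominates_transitive R \<longleftrightarrow> (\<exists>v x y z. {(v, x), (v, y), (v, z), (x, y), (y, z), (x, z)} \<subseteq> R)"

lemma isomorphic_sym: "isomorphic V R W S \<Longrightarrow> isomorphic W S V R"
proof -
  assume "isomorphic V R W S"
  then obtain f where f: "bij_betw f V W" "\<forall>i\<in>V. \<forall>j\<in>V. (i, j) \<in> R \<longleftrightarrow> (f i, f j) \<in> S"
    by (auto simp: isomorphic_def tournament_iso_def)
  then have "tournament_iso W S V R (inv_into V f)"
    by (auto simp: tournament_iso_def bij_betw_inv_into bij_betw_inv_into_right
        bij_betw_apply[OF bij_betw_inv_into])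
  then show ?thesis
    by (auto simp: isomorphic_def)
qed

lemma isomorphic_trans:
  "isomorphic V R W S \<Longrightarrow> isomorphic W S U Q \<Longrightarrow> isomorphic V R U Q"
proof -
  assume "isomorphic V R W S" "isomorphic W S U Q"
  then obtain f g where "tournament_iso V R W S f" "tournament_iso W S U Q g"
    by (auto simp: isomorphic_def)
  then have "tournament_iso V R U Q (g \<circ> f)"
    by (auto simp: tournament_iso_def bij_betw_apply intro: bij_betw_trans)
  then show ?thesis
    by (auto simp: isomorphic_def)
qed

text \<open>An isomorphism controls edges only between vertices of \<open>V\<close>;
  \<open>R \<subseteq> V \<times> V\<close> places the whole pattern there.\<close>

lemma
  assumes "isomorphic V R W S" "R \<subseteq> V \<times> V"
  shows isomorphic_dominates_cycle: "dominates_cycle R \<Longrightarrow> dominates_cycle S"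
    and isomorphic_dominates_transitive: "dominates_transitive R \<Longrightarrow> dominates_transitive S"
proof -
  obtain f where "\<forall>i\<in>V. \<forall>j\<in>V. (i, j) \<in> R \<longleftrightarrow> (f i, f j) \<in> S"
    using assms(1) by (auto simp: isomorphic_def tournament_iso_def)
  with assms(2) have f: "(i, j) \<in> R \<Longrightarrow> (f i, f j) \<in> S" for i j
    by auto
  show "dominates_cycle R \<Longrightarrow> dominates_cycle S"
    unfolding dominates_cycle_def insert_subset by (blast intro: f)
  show "dominates_transitive R \<Longrightarrow> dominates_transitive S"
    unfolding dominates_transitive_def insert_subset by (blast intro: f)
qed

text \<open>Translations preserve \<open>Gamma A\<close>, so the dominating vertex can be moved to
  0, whose outputs are exactly \<open>A\<close>. For a concrete \<open>A\<close> a small finite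
  search remains.\<close>

lemma dominates_Gamma_iff:
  "dominates_cycle (Gamma A) \<longleftrightarrow> (\<exists>x\<in>A. \<exists>y\<in>A. \<exists>z\<in>A. y - x \<in> A \<and> z - y \<in> A \<and> x - z \<in> A)"
  "dominates_transitive (Gamma A) \<longleftrightarrow> (\<exists>x\<in>A. \<exists>y\<in>A. \<exists>z\<in>A. y - x \<in> A \<and> z - y \<in> A \<and> z - x \<in> A)"
proof -
  have "dominates_cycle (Gamma A)"
    if "\<exists>x\<in>A. \<exists>y\<in>A. \<exists>z\<in>A. y - x \<in> A \<and> z - y \<in> A \<and> x - z \<in> A"
    unfolding dominates_cycle_def Gamma_def by (rule exI[of _ 0]) (use that in auto)
  moreover have "dominates_transitive (Gamma A)"
    if "\<exists>x\<in>A. \<exists>y\<in>A. \<exists>z\<in>A. y - x \<in> A \<and> z - y \<in> A \<and> z - x \<in> A"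
    unfolding dominates_transitive_def Gamma_def by (rule exI[of _ 0]) (use that in auto)
  moreover have "\<exists>x\<in>A. \<exists>y\<in>A. \<exists>z\<in>A. y - x \<in> A \<and> z - y \<in> A \<and> x - z \<in> A"
    if dom: "dominates_cycle (Gamma A)"
  proof -
    obtain v x y z where "x - v \<in> A" "y - v \<in> A" "z - v \<in> A" "y - x \<in> A" "z - y \<in> A" "x - z \<in> A"
      using dom unfolding dominates_cycle_def Gamma_def insert_subset mem_Collect_eq case_prod_conv
      by blast
    then show ?thesis
      by (intro bexI[of _ "x - v"] bexI[of _ "y - v"] bexI[of _ "z - v"]) auto
  qed
  moreover have "\<exists>x\<in>A. \<exists>y\<in>A. \<exists>z\<in>A. y - x \<in> A \<and> z - y \<in> A \<and> z - x \<in> A"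
    if dom: "dominates_transitive (Gamma A)"
  proof -
    obtain v x y z where "x - v \<in> A" "y - v \<in> A" "z - v \<in> A" "y - x \<in> A" "z - y \<in> A" "z - x \<in> A"
      using dom unfolding dominates_transitive_def Gamma_def insert_subset mem_Collect_eq case_prod_conv
      by blast
    then show ?thesis
      by (intro bexI[of _ "x - v"] bexI[of _ "y - v"] bexI[of _ "z - v"]) auto
  qed
  ultimately show
    "dominates_cycle (Gamma A) \<longleftrightarrow> (\<exists>x\<in>A. \<exists>y\<in>A. \<exists>z\<in>A. y - x \<in> A \<and> z - y \<in> A \<and> x - z \<in> A)"
    "dominates_transitive (Gamma A) \<longleftrightarrow> (\<exists>x\<in>A. \<exists>y\<in>A. \<exists>z\<in>A. y - x \<in> A \<and> z - y \<in> A \<and> z - x \<in> A)"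
    by blast+
qed

lemma not_dominates_cycle_Gamma_I: "\<not> dominates_cycle Gamma_I"
  unfolding Gamma_I_def dominates_Gamma_iff by simp

lemma dominates_cycle_Gamma_II: "dominates_cycle Gamma_II"
  unfolding Gamma_II_def dominates_Gamma_iff by simp

lemma not_dominates_transitive_Gamma_II: "\<not> dominates_transitive Gamma_II"
  unfolding Gamma_II_def dominates_Gamma_iff by simp

lemma dominates_cycle_Gamma_III: "dominates_cycle Gamma_III"
  unfolding dominates_cycle_def Gamma_III_def
  \<comment> \<open>Vertex 0 beats the cycle 1 -> 2 -> 4 -> 1.\<close>
  by (rule exI[of _ 0], rule exI[of _ 1], rule exI[of _ 2], rule exI[of _ 4]) simp

lemma dominates_transitive_Gamma_III: "dominates_transitive Gamma_III"
  unfolding dominates_transitive_def Gamma_III_def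
  \<comment> \<open>Vertex 1 beats 5, 2 and 3, where 5 -> 2 -> 3 and 5 -> 3.\<close>
  by (rule exI[of _ 1], rule exI[of _ 5], rule exI[of _ 2], rule exI[of _ 3]) simp

section \<open>Labelled games\<close>

text \<open>Every orientation of a triangle has a directed path through its three vertices. With the
  path fixed, the edge between \<open>a\<close> and \<open>c\<close> alone decides between cyclic
  and transitive.\<close>

lemma tournament_triple_path:
  assumes "tournament V R" "T \<subseteq> V" "card T = 3"
  obtains a b c where "T = {a, b, c}" "a \<noteq> b" "a \<noteq> c" "b \<noteq> c" "(a, b) \<in> R" "(b, c) \<in> R"
proof -
  obtain a b c where T: "T = {a, b, c}" "a \<noteq> b" "a \<noteq> c" "b \<noteq> c"
    using assms(3) unfolding card_3_iff by blast
  then have "(a, b) \<in> R \<or> (b, a) \<in> R" "(a, c) \<in> R \<or> (c, a) \<in> R" "(b, c) \<in> R \<or> (c, b) \<in> R"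
    using assms(1,2) unfolding tournament_def insert_subset by blast+
  then consider "(a, b) \<in> R" "(b, c) \<in> R" | "(a, c) \<in> R" "(c, b) \<in> R"
    | "(b, a) \<in> R" "(a, c) \<in> R" | "(b, c) \<in> R" "(c, a) \<in> R"
    | "(c, a) \<in> R" "(a, b) \<in> R" | "(c, b) \<in> R" "(b, a) \<in> R"
    by blast
  then show ?thesis
  proof cases
    case 1
    with T show ?thesis by (intro that[of a b c]) auto
  next
    case 2
    with T show ?thesis by (intro that[of a c b]) auto
  next
    case 3
    with T show ?thesis by (intro that[of b a c]) auto
  next
    case 4
    with T show ?thesis by (intro that[of b c a]) auto
  next
    case 5
    with T show ?thesis by (intro that[of c a b]) auto
  next
    case 6
    with T show ?thesis by (intro that[of c b a]) auto
  qed
qed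

section \<open>Degree counts and residues modulo 7\<close>

lemma length_filter_conv_sum_list: "length (filter P xs) = (\<Sum>x\<leftarrow>xs. of_bool (P x))"
  by (induction xs) auto

lemma all_7_iff: "(\<forall>i::7. P i) \<longleftrightarrow> P 0 \<and> P 1 \<and> P 2 \<and> P 3 \<and> P 4 \<and> P 5 \<and> P 6"
  by (simp add: UNIV_7 flip: ball_UNIV)

text \<open>A residue up to 6 plus a step of at most 4 reaches at most 10.\<close>

lemma numeral_mod_7: "7 = (0 :: 7)" "8 = (1 :: 7)" "9 = (2 :: 7)" "10 = (3 :: 7)"
  by simp_all

text \<open>These are the shapes of the equations in \<open>degrees\<close>, which thereby become
  propositional.\<close>

lemma of_bool_sum_iff:
  "of_bool P + of_bool Q + of_bool S = (2 :: nat) \<longleftrightarrow>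
     P \<and> Q \<and> \<not> S \<or> P \<and> \<not> Q \<and> S \<or> \<not> P \<and> Q \<and> S"
  "of_bool P + of_bool Q + of_bool S = (if A then 2 else 1 :: nat) \<longleftrightarrow>
     (if A then P \<and> Q \<and> \<not> S \<or> P \<and> \<not> Q \<and> S \<or> \<not> P \<and> Q \<and> S
      else P \<and> \<not> Q \<and> \<not> S \<or> \<not> P \<and> Q \<and> \<not> S \<or> \<not> P \<and> \<not> Q \<and> S)"
  "of_bool P + of_bool Q + of_bool S = (if A then 2 else 3 :: nat) \<longleftrightarrow>
     (if A then P \<and> Q \<and> \<not> S \<or> P \<and> \<not> Q \<and> S \<or> \<not> P \<and> Q \<and> S else P \<and> Q \<and> S)"
  by auto

text \<open>The closing edges of the two paths stay open, so cyclic and transitive triples share one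
  setting.\<close>

locale labelled_game7 =
  fixes V :: "'a set" and R :: "'a rel" and v a b c x y z :: 'a
  assumes game: "game7 V R"
    and distinct: "distinct [v, a, b, c, x, y, z]"
    and V: "V = {v, a, b, c, x, y, z}"
    and out_v: "(v, a) \<in> R" "(v, b) \<in> R" "(v, c) \<in> R"
    and in_v: "(x, v) \<in> R" "(y, v) \<in> R" "(z, v) \<in> R"
    and paths: "(a, b) \<in> R" "(b, c) \<in> R" "(x, y) \<in> R" "(y, z) \<in> R"
begin

lemma tournament: "tournament V R" and card_V: "card V = 7"
  using game by (simp_all add: game7_def)

lemma not_refl: "(i, i) \<notin> R"
  using tournament by (auto simp: tournament_def irrefl_def)

lemma converse_iff: "i \<in> V \<Longrightarrow> j \<in> V \<Longrightarrow> i \<noteq> j \<Longrightarrow> (j, i) \<in> R \<longleftrightarrow> (i, j) \<notin> R"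
  using tournament unfolding tournament_def by blast

text \<open>As rewrite rules, these leave eleven open atoms: \<open>(c, a)\<close>,
  \<open>(z, x)\<close> and the nine pairs from an output of \<open>v\<close> to an input of
  \<open>v\<close>.\<close>

lemma backward:
  "(a, v) \<notin> R" "(b, v) \<notin> R" "(c, v) \<notin> R" "(v, x) \<notin> R" "(v, y) \<notin> R" "(v, z) \<notin> R"
  "(b, a) \<notin> R" "(c, b) \<notin> R" "(y, x) \<notin> R" "(z, y) \<notin> R"
  "(a, c) \<in> R \<longleftrightarrow> (c, a) \<notin> R" "(x, z) \<in> R \<longleftrightarrow> (z, x) \<notin> R"
  "(x, a) \<in> R \<longleftrightarrow> (a, x) \<notin> R" "(x, b) \<in> R \<longleftrightarrow> (b, x) \<notin> R" "(x, c) \<in> R \<longleftrightarrow> (c, x) \<notin> R"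
  "(y, a) \<in> R \<longleftrightarrow> (a, y) \<notin> R" "(y, b) \<in> R \<longleftrightarrow> (b, y) \<notin> R" "(y, c) \<in> R \<longleftrightarrow> (c, y) \<notin> R"
  "(z, a) \<in> R \<longleftrightarrow> (a, z) \<notin> R" "(z, b) \<in> R \<longleftrightarrow> (b, z) \<notin> R" "(z, c) \<in> R \<longleftrightarrow> (c, z) \<notin> R"
  by (subst converse_iff; use distinct in \<open>auto simp: V paths out_v in_v\<close>)+

lemma out_degree:
  assumes "i \<in> V"
  shows "(\<Sum>j\<leftarrow>[v, a, b, c, x, y, z]. of_bool ((i, j) \<in> R)) = (3 :: nat)"
proof -
  have "{j \<in> V. (i, j) \<in> R} = set (filter (\<lambda>j. (i, j) \<in> R) [v, a, b, c, x, y, z])"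
    by (auto simp: V)
  moreover have "distinct (filter (\<lambda>j. (i, j) \<in> R) [v, a, b, c, x, y, z])"
    using distinct by (rule distinct_filter)
  moreover have "card {j \<in> V. (i, j) \<in> R} = 3"
    using game assms by (simp only: game7_def)
  ultimately have "length (filter (\<lambda>j. (i, j) \<in> R) [v, a, b, c, x, y, z]) = 3"
    by (simp only: distinct_card)
  then show ?thesis
    by (simp only: length_filter_conv_sum_list)
qed

text \<open>Row and column sums of the 0-1 matrix of edges from \<open>a\<close>, \<open>b\<close>,
  \<open>c\<close> to \<open>x\<close>, \<open>y\<close>, \<open>z\<close>. A row sum is 3 minus the
  outputs inside the triple; for a column, the outputs of its vertex in the other triple are the
  zeros.\<close>

lemma degrees:
  "of_bool ((a, x) \<in> R) + of_bool ((a, y) \<in> R) + of_bool ((a, z) \<in> R) =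
     (if (c, a) \<in> R then 2 else 1 :: nat)"
    (is ?a)
  "of_bool ((b, x) \<in> R) + of_bool ((b, y) \<in> R) + of_bool ((b, z) \<in> R) = (2 :: nat)"
    (is ?b)
  "of_bool ((c, x) \<in> R) + of_bool ((c, y) \<in> R) + of_bool ((c, z) \<in> R) =
     (if (c, a) \<in> R then 2 else 3 :: nat)"
    (is ?c)
  "of_bool ((a, x) \<in> R) + of_bool ((b, x) \<in> R) + of_bool ((c, x) \<in> R) =
     (if (z, x) \<in> R then 2 else 3 :: nat)"
    (is ?x)
  "of_bool ((a, y) \<in> R) + of_bool ((b, y) \<in> R) + of_bool ((c, y) \<in> R) = (2 :: nat)"
    (is ?y)
  "of_bool ((a, z) \<in> R) + of_bool ((b, z) \<in> R) + of_bool ((c, z) \<in> R) =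
     (if (z, x) \<in> R then 2 else 1 :: nat)"
    (is ?z)
proof -
  have vertices: "a \<in> V" "b \<in> V" "c \<in> V" "x \<in> V" "y \<in> V" "z \<in> V"
    by (simp_all add: V)
  note simps = backward paths out_v in_v not_refl of_bool_def
  show ?a
    using out_degree[OF vertices(1)] by (simp add: simps split: if_splits)
  show ?b
    using out_degree[OF vertices(2)] by (simp add: simps split: if_splits)
  show ?c
    using out_degree[OF vertices(3)] by (simp add: simps split: if_splits)
  show ?x
    using out_degree[OF vertices(4)] by (simp add: simps split: if_splits)
  show ?y
    using out_degree[OF vertices(5)] by (simp add: simps split: if_splits)
  show ?z
    using out_degree[OF vertices(6)] by (simp add: simps split: if_splits)
qed

text \<open>With the images of 0 to 6 listed in order, the edge condition becomes ground facts for
  the simplifier.\<close>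

lemma isomorphic_Gamma_III_I:
  assumes "set fs \<subseteq> V" "length fs = 7" "\<forall>(i, j)\<in>Gamma_III. (fs ! i, fs ! j) \<in> R"
  shows "isomorphic V R {0..6} Gamma_III"
  using tournament
proof (rule tournament_isomorphicI[where f = "(!) fs"])
  show "tournament {0..6} Gamma_III" "card V = card {0..6::nat}"
    using game7_Gamma_III card_V by (simp_all add: game7_def)
  show "(!) fs ` {0..6} \<subseteq> V"
    using assms(1,2) by (auto simp: subset_iff)
  show "(fs ! i, fs ! j) \<in> R" if "(i, j) \<in> Gamma_III" for i j
    using assms(3) that by blast
qed

section \<open>The four combinations of transitive and cyclic triples\<close>

lemma transitive_transitive:
  assumes "(a, c) \<in> R" "(x, z) \<in> R"
  shows "isomorphic V R (UNIV :: 7 set) Gamma_I"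
proof -
  \<comment> \<open>Row sums 1, 2, 3 and column sums 3, 2, 1 admit a single matrix.\<close>
  have E: "(a, x) \<in> R" "(b, x) \<in> R" "(b, y) \<in> R" "(c, x) \<in> R" "(c, y) \<in> R" "(c, z) \<in> R"
    "(a, y) \<notin> R" "(a, z) \<notin> R" "(b, z) \<notin> R"
    using assms degrees unfolding of_bool_sum_iff by (auto simp: backward)
  \<comment> \<open>In the cyclic order \<open>v\<close>, \<open>a\<close>, \<open>b\<close>,
    \<open>c\<close>, \<open>x\<close>, \<open>y\<close>, \<open>z\<close> each vertex beats the
    next three.\<close>
  define f :: "7 \<Rightarrow> 'a" where
    "f i = (if i = 0 then v else if i = 1 then a else if i = 2 then b else if i = 3 then c
      else if i = 4 then x else if i = 5 then y else z)" for i
  have f: "f 0 = v" "f 1 = a" "f 2 = b" "f 3 = c" "f 4 = x" "f 5 = y" "f 6 = z"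
    by (simp_all add: f_def)
  have edge: "\<forall>i. \<forall>d\<in>{1, 2, 3}. (f i, f (i + d)) \<in> R"
    using E assms by (simp add: all_7_iff numeral_mod_7 f backward paths out_v in_v)
  show ?thesis
    using tournament
  proof (rule tournament_isomorphicI)
    show "tournament (UNIV :: 7 set) Gamma_I" "card V = card (UNIV :: 7 set)"
      using game7_Gamma_I card_V by (simp_all add: game7_def)
    show "range f \<subseteq> V"
      by (auto simp: f_def V)
    show "(f i, f j) \<in> R" if "(i, j) \<in> Gamma_I" for i j
      using that edge[rule_format, of "j - i" i] by (simp add: Gamma_I_def Gamma_def)
  qed
qed

text \<open>With row sums 1, 2, 3 and column sums 2, \<open>c\<close> beats all inputs of
  \<open>v\<close>, and \<open>b\<close> beats exactly those that \<open>a\<close> does not.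
  Rotating the cycle of inputs achieves \<open>(a, x) \<in> R\<close>.\<close>

lemma transitive_cyclic:
  assumes "(a, c) \<in> R" "(z, x) \<in> R" "(a, x) \<in> R"
  shows "isomorphic V R {0..6} Gamma_III"
proof (rule isomorphic_Gamma_III_I)
  have "(b, y) \<in> R" "(b, z) \<in> R" "(c, x) \<in> R" "(c, y) \<in> R" "(c, z) \<in> R"
    "(a, y) \<notin> R" "(a, z) \<notin> R" "(b, x) \<notin> R"
    using assms degrees unfolding of_bool_sum_iff by (auto simp: backward)
  \<comment> \<open>Here \<open>x\<close> plays 0: its outputs \<open>v\<close> -> \<open>b\<close>
    -> \<open>y\<close> -> \<open>v\<close> and inputs \<open>c\<close> -> \<open>z\<close> ->
    \<open>a\<close> -> \<open>c\<close> are both cyclic, as at vertex 0 of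
    \<open>Gamma_III\<close>.\<close>
  with assms show "\<forall>(i, j)\<in>Gamma_III. ([x, v, b, c, y, a, z] ! i, [x, v, b, c, y, a, z] ! j) \<in> R"
    by (simp add: Gamma_III_def backward paths out_v in_v)
qed (auto simp: V)

text \<open>With column sums 3, 2, 1 a single output of \<open>v\<close> beats \<open>z\<close>;
  rotation makes it \<open>a\<close>, and row sums 2 fix the rest.\<close>

lemma cyclic_transitive:
  assumes "(c, a) \<in> R" "(x, z) \<in> R" "(a, z) \<in> R"
  shows "isomorphic V R {0..6} Gamma_III"
proof (rule isomorphic_Gamma_III_I)
  have "(a, x) \<in> R" "(b, x) \<in> R" "(b, y) \<in> R" "(c, x) \<in> R" "(c, y) \<in> R"
    "(a, y) \<notin> R" "(b, z) \<notin> R" "(c, z) \<notin> R"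
    using assms degrees unfolding of_bool_sum_iff by (auto simp: backward)
  \<comment> \<open>Now \<open>a\<close> plays 0, with output cycle \<open>b\<close> ->
    \<open>x\<close> -> \<open>z\<close> -> \<open>b\<close> and input cycle \<open>y\<close> ->
    \<open>v\<close> -> \<open>c\<close> -> \<open>y\<close>.\<close>
  with assms show "\<forall>(i, j)\<in>Gamma_III. ([a, b, x, y, z, c, v] ! i, [a, b, x, y, z, c, v] ! j) \<in> R"
    by (simp add: Gamma_III_def backward paths out_v in_v)
qed (auto simp: V)

text \<open>All sums are 2, so the zeros form a permutation matrix, here \<open>x\<close> ->
  \<open>a\<close>, \<open>y\<close> -> \<open>b\<close>, \<open>z\<close> -> \<open>c\<close>. It
  corresponds to 6 -> 1, 5 -> 2, 3 -> 4 in \<open>Gamma_III\<close>.\<close>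

lemma cyclic_cyclic_preserving:
  assumes "(c, a) \<in> R" "(z, x) \<in> R" "(x, a) \<in> R" "(y, b) \<in> R"
  shows "isomorphic V R {0..6} Gamma_III"
proof (rule isomorphic_Gamma_III_I)
  have "(a, y) \<in> R" "(a, z) \<in> R" "(b, x) \<in> R" "(b, z) \<in> R" "(c, x) \<in> R" "(c, y) \<in> R"
    "(c, z) \<notin> R" "(a, x) \<notin> R" "(b, y) \<notin> R"
    using assms degrees unfolding of_bool_sum_iff by (auto simp: backward)
  with assms show "\<forall>(i, j)\<in>Gamma_III. ([v, a, b, z, c, y, x] ! i, [v, a, b, z, c, y, x] ! j) \<in> R"
    by (simp add: Gamma_III_def backward paths out_v in_v)
qed (auto simp: V)

lemma cyclic_cyclic_reversing:
  assumes "(c, a) \<in> R" "(z, x) \<in> R" "(x, a) \<in> R" "(b, y) \<in> R"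
  shows "isomorphic V R (UNIV :: 7 set) Gamma_II"
proof -
  have E: "(a, y) \<in> R" "(a, z) \<in> R" "(b, x) \<in> R" "(c, x) \<in> R" "(c, z) \<in> R"
    "(c, y) \<notin> R" "(a, x) \<notin> R" "(b, z) \<notin> R"
    using assms degrees unfolding of_bool_sum_iff by (auto simp: backward)
  \<comment> \<open>The matching is \<open>x\<close> -> \<open>a\<close>, \<open>z\<close> ->
    \<open>b\<close>, \<open>y\<close> -> \<open>c\<close>. In \<open>Gamma_II\<close> the inputs of
    0 are the negatives of its outputs 1, 2, 4, each -d beats d, and negation reverses the cycle; so
    6, 5, 3 go to \<open>x\<close>, \<open>z\<close>, \<open>y\<close>.\<close>
  define f :: "7 \<Rightarrow> 'a" where
    "f i = (if i = 0 then v else if i = 1 then a else if i = 2 then b else if i = 3 then y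
      else if i = 4 then c else if i = 5 then z else x)" for i
  have f: "f 0 = v" "f 1 = a" "f 2 = b" "f 3 = y" "f 4 = c" "f 5 = z" "f 6 = x"
    by (simp_all add: f_def)
  have edge: "\<forall>i. \<forall>d\<in>{1, 2, 4}. (f i, f (i + d)) \<in> R"
    using E assms by (simp add: all_7_iff numeral_mod_7 f backward paths out_v in_v)
  show ?thesis
    using tournament
  proof (rule tournament_isomorphicI)
    show "tournament (UNIV :: 7 set) Gamma_II" "card V = card (UNIV :: 7 set)"
      using game7_Gamma_II card_V by (simp_all add: game7_def)
    show "range f \<subseteq> V"
      by (auto simp: f_def V)
    show "(f i, f j) \<in> R" if "(i, j) \<in> Gamma_II" for i j
      using that edge[rule_format, of "j - i" i] by (simp add: Gamma_II_def Gamma_def)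
  qed
qed

text \<open>When the closing edge makes the triple a cycle, its path may start one vertex later;
  this justifies the normalisations in the case lemmas.\<close>

lemma rotate_out: "(c, a) \<in> R \<Longrightarrow> labelled_game7 V R v b c a x y z"
  using labelled_game7_axioms by (auto simp: labelled_game7_def)

lemma rotate_in: "(z, x) \<in> R \<Longrightarrow> labelled_game7 V R v a b c y z x"
  using labelled_game7_axioms by (auto simp: labelled_game7_def)

lemma classification:
  "isomorphic V R (UNIV :: 7 set) Gamma_I \<or> isomorphic V R (UNIV :: 7 set) Gamma_II \<or>
   isomorphic V R {0..6} Gamma_III"
proof (cases "(c, a) \<in> R"; cases "(z, x) \<in> R")
  assume "(c, a) \<notin> R" "(z, x) \<notin> R"
  then show ?thesis
    by (simp add: transitive_transitive backward)
next
  assume *: "(c, a) \<notin> R" "(z, x) \<in> R"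
  interpret r1: labelled_game7 V R v a b c y z x
    using *(2) by (rule rotate_in)
  interpret r2: labelled_game7 V R v a b c z x y
    by (rule r1.rotate_in) (rule paths)
  \<comment> \<open>Row \<open>a\<close> has a positive sum, so one of the three rotations meets the
    assumption of \<open>transitive_cyclic\<close>.\<close>
  have "(a, x) \<in> R \<or> (a, y) \<in> R \<or> (a, z) \<in> R"
    using degrees(1) unfolding of_bool_sum_iff by (auto split: if_splits)
  then show ?thesis
    using * transitive_cyclic r1.transitive_cyclic r2.transitive_cyclic paths backward(11) by blast
next
  assume *: "(c, a) \<in> R" "(z, x) \<notin> R"
  interpret r1: labelled_game7 V R v b c a x y z
    using *(1) by (rule rotate_out)
  interpret r2: labelled_game7 V R v c a b x y z
    by (rule r1.rotate_out) (rule paths)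
  have "(a, z) \<in> R \<or> (b, z) \<in> R \<or> (c, z) \<in> R"
    using degrees(6) unfolding of_bool_sum_iff by (auto split: if_splits)
  then show ?thesis
    using * cyclic_transitive r1.cyclic_transitive r2.cyclic_transitive paths backward(12) by blast
next
  assume *: "(c, a) \<in> R" "(z, x) \<in> R"
  interpret r1: labelled_game7 V R v a b c y z x
    using *(2) by (rule rotate_in)
  interpret r2: labelled_game7 V R v a b c z x y
    by (rule r1.rotate_in) (rule paths)
  \<comment> \<open>Row \<open>a\<close> has a zero; rotate its column to \<open>x\<close>. The edge
    between \<open>b\<close> and the successor of that input then decides between preserving and
    reversing.\<close>
  have "(x, a) \<in> R \<or> (y, a) \<in> R \<or> (z, a) \<in> R"
    using degrees(1) unfolding of_bool_sum_iff by (auto simp: backward split: if_splits)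
  moreover have "(y, b) \<in> R \<or> (b, y) \<in> R" "(z, b) \<in> R \<or> (b, z) \<in> R" "(x, b) \<in> R \<or> (b, x) \<in> R"
    by (simp_all add: backward)
  ultimately show ?thesis
    using * paths cyclic_cyclic_preserving r1.cyclic_cyclic_preserving r2.cyclic_cyclic_preserving
      cyclic_cyclic_reversing r1.cyclic_cyclic_reversing r2.cyclic_cyclic_reversing
    by blast
qed

end

section \<open>Labelling an arbitrary game and telling the models apart\<close>

lemma game7_labelling:
  assumes "game7 V R"
  obtains v a b c x y z where "labelled_game7 V R v a b c x y z"
proof -
  have t: "tournament V R" and "card V = 7"
    using assms by (simp_all add: game7_def)
  then obtain v where v: "v \<in> V"
    by (metis all_not_in_conv card.empty zero_neq_numeral)
  define T S where "T = {j\<in>V. (v, j) \<in> R}" and "S = {j\<in>V. (j, v) \<in> R}"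
  have "card T = 3" "card S = 3" "T \<subseteq> V" "S \<subseteq> V"
    using assms v by (auto simp: T_def S_def game7_def)
  then obtain a b c x y z where
    abc: "T = {a, b, c}" "a \<noteq> b" "a \<noteq> c" "b \<noteq> c" "(a, b) \<in> R" "(b, c) \<in> R" and
    xyz: "S = {x, y, z}" "x \<noteq> y" "x \<noteq> z" "y \<noteq> z" "(x, y) \<in> R" "(y, z) \<in> R"
    using tournament_triple_path[OF t] by metis
  have "(v, v) \<notin> R"
    using t by (simp add: tournament_def irrefl_def)
  moreover have "(j, v) \<in> R \<longleftrightarrow> (v, j) \<notin> R" if "j \<in> V" "j \<noteq> v" for j
    using t v that unfolding tournament_def by blast
  ultimately have "V = {v} \<union> T \<union> S" "v \<notin> T" "v \<notin> S" "T \<inter> S = {}"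
    using v unfolding T_def S_def by blast+
  moreover have "\<forall>j\<in>T. (v, j) \<in> R" "\<forall>j\<in>S. (j, v) \<in> R"
    by (auto simp: T_def S_def)
  ultimately have "labelled_game7 V R v a b c x y z"
    using assms abc xyz by (auto simp: labelled_game7_def)
  with that show ?thesis .
qed

theorem theorem10p1:
  fixes V :: "'a set" and R :: "'a rel"
  assumes "game7 V R"
  shows "(isomorphic V R (UNIV :: 7 set) Gamma_I \<or>
          isomorphic V R (UNIV :: 7 set) Gamma_II \<or>
          isomorphic V R {0..6} Gamma_III) \<and>
         \<not> (isomorphic V R (UNIV :: 7 set) Gamma_I \<and>
            isomorphic V R (UNIV :: 7 set) Gamma_II) \<and>
         \<not> (isomorphic V R (UNIV :: 7 set) Gamma_I \<and>
            isomorphic V R {0..6} Gamma_III) \<and>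
         \<not> (isomorphic V R (UNIV :: 7 set) Gamma_II \<and>
            isomorphic V R {0..6} Gamma_III)"
proof -
  obtain v a b c x y z where "labelled_game7 V R v a b c x y z"
    using game7_labelling[OF assms] .
  note classification = labelled_game7.classification[OF this]
  have sub: "Gamma_III \<subseteq> {0..6} \<times> {0..6}"
    using game7_Gamma_III by (simp add: game7_def tournament_def)
  \<comment> \<open>Each isomorphism is refuted in the direction from the model with the pattern to
    the one without it; symmetry and transitivity turn two models of the same game into such a
    pair.\<close>
  have "\<not> isomorphic (UNIV :: 7 set) Gamma_II (UNIV :: 7 set) Gamma_I"
    using isomorphic_dominates_cycle[of UNIV Gamma_II] dominates_cycle_Gamma_II
      not_dominates_cycle_Gamma_I by auto
  moreover have "\<not> isomorphic {0..6} Gamma_III (UNIV :: 7 set) Gamma_I"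
    using isomorphic_dominates_cycle[OF _ sub] dominates_cycle_Gamma_III
      not_dominates_cycle_Gamma_I by auto
  moreover have "\<not> isomorphic {0..6} Gamma_III (UNIV :: 7 set) Gamma_II"
    using isomorphic_dominates_transitive[OF _ sub] dominates_transitive_Gamma_III
      not_dominates_transitive_Gamma_II by auto
  ultimately show ?thesis
    using classification isomorphic_sym isomorphic_trans by metis
qed

end
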